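(* Let $A$ be a symmetric real $p\times p$ matrix, $B$ a symmetric positive definite real $p\times p$ matrix, and $k \le \mathsf{m}_1 < \mathsf{m}_2 \le p$ positive integers. Let $U_{\mathsf{m}_2}$ be a $p\times \mathsf{m}_2$ real matrix with orthonormal columns and column span $\mathcal U_{\mathsf{m}_2}$, and put $H = U_{\mathsf{m}_2}^TAU_{\mathsf{m}_2}$, $K = U_{\mathsf{m}_2}^TBU_{\mathsf{m}_2}$ and \[ \rho_{\mathsf{m}_2} = \max_{V\subset\mathcal U_{\mathsf{m}_2},\ V^TV=I_k}\rho(V) = \max_{Z^TZ=I_k}\frac{\operatorname{tr}(Z^THZ)}{\operatorname{tr}(Z^TKZ)}, \] where in the last maximum $Z$ ranges over real $\mathsf{m}_2\times k$ matrices. Let $Z_{\mathsf{m}_1} = [Z\ \ Z_{\mathsf{m}_1-k}]$ be an $\mathsf{m}_2\times\mathsf{m}_1$ matrix with orthonormal columns, such that the columns of $Z$ ($\mathsf{m}_2\times k$) are eigenvectors of $H-\rho_{\mathsf{m}_2}K$ associated with its $k$ largest eigenvalues (so that $Z$ attains the last maximum), and the columns of $Z_{\mathsf{m}_1-k}$ are eigenvectors of $H-\rho_{\mathsf{m}_2}K$ associated with the next $\mathsf{m}_1-k$ largest eigenvalues (counted with multiplicity). Let $\mathcal U_{\mathsf{m}_1}$ be the column span of $U_{\mathsf{m}_1} = U_{\mathsf{m}_2}Z_{\mathsf{m}_1}$. Then $\mathcal U_{\mathsf{m}_1}\subset\mathcal U_{\mathsf{m}_2}$ and \[ \max_{V\subset\mathcal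 U_{\mathsf{m}_1},\ V^TV=I_k}\rho(V) = \rho_{\mathsf{m}_2}, \] and the maximum on the left-hand side is attained at $V = U_{\mathsf{m}_2}Z$.
   Context: For a $p\times k$ real matrix $V$ with orthonormal columns ($V^TV=I_k$), the trace ratio is $\rho(V) = \operatorname{tr}(V^TAV)/\operatorname{tr}(V^TBV)$. For a subspace $\mathcal U$ of $\mathbb R^p$, the notation $V\subset\mathcal U$ means that all columns of the $p\times k$ matrix $V$ lie in $\mathcal U$. *)

theory Defs
  imports "Jordan_Normal_Form.VS_Connect" "Jordan_Normal_Form.Char_Poly"
begin

definition mat_trace :: "real mat \<Rightarrow> real" where
  "mat_trace A = sum_list (diag_mat A)"

definition trace_ratio :: "real mat \<Rightarrow> real mat \<Rightarrow> real mat \<Rightarrow> real" where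
  "trace_ratio A B V = mat_trace (V\<^sup>T * A * V) / mat_trace (V\<^sup>T * B * V)"

definition positive_definite :: "nat \<Rightarrow> real mat \<Rightarrow> bool" where
  "positive_definite n B \<longleftrightarrow>
     (\<forall>v \<in> carrier_vec n. v \<noteq> 0\<^sub>v n \<longrightarrow> 0 < v \<bullet> (B *\<^sub>v v))"

definition orthonormal_mats :: "nat \<Rightarrow> nat \<Rightarrow> real mat set" where
  "orthonormal_mats n k = {V \<in> carrier_mat n k. V\<^sup>T * V = 1\<^sub>m k}"

definition orthonormal_mats_in :: "nat \<Rightarrow> nat \<Rightarrow> real vec set \<Rightarrow> real mat set" where
  "orthonormal_mats_in n k \<U> = {V \<in> orthonormal_mats n k. set (cols V) \<subseteq> \<U>}"

abbreviation col_span :: "nat \<Rightarrow> real mat \<Rightarrow> real vec set" where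
  "col_span n U \<equiv> vec_space.col_space n U"

definition append_columns :: "real mat \<Rightarrow> real mat \<Rightarrow> real mat" where
  "append_columns Z Y = mat_of_cols (dim_row Z) (cols Z @ cols Y)"

(* The real roots of the characteristic polynomial, with multiplicity, in nonincreasing
   order. For a symmetric n x n matrix all roots are real and the list has length n. *)
definition eigenvalues_desc :: "real mat \<Rightarrow> real list" where
  "eigenvalues_desc M = rev (sorted_list_of_multiset (proots (char_poly M)))"

(* The columns of Z are eigenvectors of M whose eigenvalues, counted with multiplicity,
   are those listed in es; the columns may appear in any order. *)
definition eigenvector_cols :: "real mat \<Rightarrow> real mat \<Rightarrow> real list \<Rightarrow> bool" where
  "eigenvector_cols M Z es \<longleftrightarrow>
     (\<exists>ds. mset ds = mset es \<and> list_all2 (eigenvector M) (cols Z) ds)"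

definition is_maximum :: "real set \<Rightarrow> real \<Rightarrow> bool" where
  "is_maximum S r \<longleftrightarrow> r \<in> S \<and> (\<forall>s \<in> S. s \<le> r)"

end

theory Submission
  imports Defs "HOL-Analysis.Function_Topology"
begin

text \<open>By compactness the trace ratio attains its maximum \<open>\<rho>\<close>, so \<open>tr (Y\<^sup>T (H - \<rho> K) Y) \<le> 0\<close> for every
  \<open>Y\<close> with orthonormal columns, with equality at a maximizer. By Ky Fan's inequality the \<open>k\<close> leading
  eigenvectors \<open>Z\<close> of \<open>H - \<rho> K\<close> have the largest value of this trace, which must therefore be 0:
  \<open>Z\<close> attains \<open>\<rho>\<close>. Since \<open>U\<^sub>2 Z\<close> lies in the column span of \<open>U\<^sub>1\<close>, passing to this smaller subspace
  does not lower the maximum.\<close>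

section \<open>Maxima over compact sets of vectors\<close>

text \<open>Tychonoff's theorem: functions into the reals carry the product topology, and the cube
  is a product of compact intervals.\<close>

lemma compact_cube: "compact {x :: 'i \<Rightarrow> real. \<forall>i. x i \<in> {-1..1}}"
proof -
  have "compactin (product_topology (\<lambda>_. euclidean) UNIV) (PiE UNIV (\<lambda>_::'i. {-1..1::real}))"
    by (subst compactin_PiE) (simp add: compactin_euclidean_iff)
  moreover have "PiE UNIV (\<lambda>_::'i. {-1..1::real}) = {x. \<forall>i. x i \<in> {-1..1}}"
    by auto
  ultimately show ?thesis
    by (simp add: euclidean_product_topology compactin_euclidean_iff)
qed

text \<open>Vectors and matrices will be encoded as functions of their indices. \<open>C\<close>
  carries the orthonormality constraints, which are closed conditions, and the cube supplies
  compactness.\<close>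

lemma attains_max_in_cube:
  fixes f :: "('i \<Rightarrow> real) \<Rightarrow> real"
  defines "S \<equiv> \<lambda>C. {x \<in> C. \<forall>i. \<bar>x i\<bar> \<le> 1}"
  assumes "closed C" and "x0 \<in> S C" and "continuous_on (S C) f"
  shows "\<exists>x \<in> S C. \<forall>y \<in> S C. f y \<le> f x"
proof -
  have "S C = {x. \<forall>i. x i \<in> {-1..1}} \<inter> C"
    unfolding S_def by (auto simp: abs_le_iff minus_le_iff)
  hence "compact (S C)"
    using compact_Int_closed[OF compact_cube assms(2)] by metis
  from continuous_attains_sup[OF this _ assms(4)] assms(3) show ?thesis by blast
qed

lemma scalar_prod_self_pos:
  fixes v :: "real vec"
  assumes "v \<in> carrier_vec n" and "v \<noteq> 0\<^sub>v n"
  shows "v \<bullet> v > 0"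
proof -
  obtain i where "i < n" "v $ i \<noteq> 0"
    using assms by (metis carrier_vecD eq_vecI index_zero_vec)
  thus ?thesis
    using assms(1) unfolding scalar_prod_def by (intro sum_pos2[of _ i]) (auto simp: zero_less_mult_iff)
qed

lemma unit_vec_index_abs_le:
  fixes v :: "real vec"
  assumes "v \<bullet> v = 1" and "i < dim_vec v"
  shows "\<bar>v $ i\<bar> \<le> 1"
proof -
  have "(v $ i)\<^sup>2 \<le> (\<Sum>j<dim_vec v. (v $ j)\<^sup>2)"
    using assms(2) by (intro member_le_sum) auto
  also have "\<dots> = v \<bullet> v"
    by (simp add: scalar_prod_def power2_eq_square lessThan_atLeast0)
  finally show ?thesis using assms(1) by (simp add: abs_square_le_1)
qed

lemma closed_Collect_ball:
  assumes "\<And>i. i \<in> I \<Longrightarrow> closed {x. P i x}"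
  shows "closed {x. \<forall>i\<in>I. P i x}"
proof -
  have "{x. \<forall>i\<in>I. P i x} = (\<Inter>i\<in>I. {x. P i x})" by auto
  thus ?thesis using assms by auto
qed

lemma rayleigh_maximizer:
  fixes M :: "real mat" and q :: "nat \<Rightarrow> real vec"
  assumes M: "M \<in> carrier_mat n n"
    and q: "\<And>i. i < r \<Longrightarrow> q i \<in> carrier_vec n"
    and v0: "v0 \<in> carrier_vec n" "v0 \<bullet> v0 = 1" "\<And>i. i < r \<Longrightarrow> q i \<bullet> v0 = 0"
  obtains v where "v \<in> carrier_vec n" "v \<bullet> v = 1" "\<And>i. i < r \<Longrightarrow> q i \<bullet> v = 0"
    "\<And>u. u \<in> carrier_vec n \<Longrightarrow> u \<bullet> u = 1 \<Longrightarrow> (\<And>i. i < r \<Longrightarrow> q i \<bullet> u = 0) \<Longrightarrow> u \<bullet> (M *\<^sub>v u) \<le> v \<bullet> (M *\<^sub>v v)"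
proof -
  define C where "C = {x :: nat \<Rightarrow> real. vec n x \<bullet> vec n x = 1} \<inter> {x. \<forall>i\<in>{..<r}. q i \<bullet> vec n x = 0}"
  define S where "S = {x \<in> C. \<forall>i. \<bar>x i\<bar> \<le> 1}"
  \<comment> \<open>Padding with 0 keeps the coordinates from \<open>n\<close> on, which
    \<open>vec n\<close> ignores, inside the cube.\<close>
  define ext where "ext u = (\<lambda>i. if i < n then u $ i else 0)" for u :: "real vec"
  have vec_ext: "vec n (ext u) = u" if "u \<in> carrier_vec n" for u
    using that by (intro eq_vecI) (auto simp: ext_def)
  have ext: "ext u \<in> S" if "u \<in> carrier_vec n" "u \<bullet> u = 1" "\<And>i. i < r \<Longrightarrow> q i \<bullet> u = 0" for u
    using that unit_vec_index_abs_le[OF that(2)] by (auto simp: S_def C_def vec_ext) (auto simp: ext_def)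
  have "closed C"
    unfolding C_def
    by (intro closed_Int closed_Collect_ball closed_Collect_eq)
      (auto simp: scalar_prod_def intro!: continuous_intros)
  moreover have "ext v0 \<in> S" using ext v0 by blast
  moreover have "continuous_on S (\<lambda>x. vec n x \<bullet> (M *\<^sub>v vec n x))"
    using M by (auto simp: scalar_prod_def intro!: continuous_intros
        intro: continuous_on_subset[OF continuous_on_product_coordinates])
  ultimately obtain x where x: "x \<in> S"
    and mx: "\<forall>y\<in>S. vec n y \<bullet> (M *\<^sub>v vec n y) \<le> vec n x \<bullet> (M *\<^sub>v vec n x)"
    using attains_max_in_cube[of C "ext v0" "\<lambda>x. vec n x \<bullet> (M *\<^sub>v vec n x)"] unfolding S_def by auto
  show ?thesis
  proof (rule that[of "vec n x"])
    show "u \<bullet> (M *\<^sub>v u) \<le> vec n x \<bullet> (M *\<^sub>v vec n x)"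
      if "u \<in> carrier_vec n" "u \<bullet> u = 1" "\<And>i. i < r \<Longrightarrow> q i \<bullet> u = 0" for u
      using mx ext[OF that] vec_ext[OF that(1)] by metis
  qed (use x in \<open>auto simp: S_def C_def\<close>)
qed

text \<open>A square matrix with the vectors \<open>q i\<close> among its rows and at least one zero
  row is singular; a nonzero kernel vector is orthogonal to every \<open>q i\<close> and only has to
  be normalized.\<close>

lemma ex_unit_orthogonal:
  fixes q :: "nat \<Rightarrow> real vec"
  assumes "r < n" and q: "\<And>i. i < r \<Longrightarrow> q i \<in> carrier_vec n"
  obtains v where "v \<in> carrier_vec n" "v \<bullet> v = 1" "\<And>i. i < r \<Longrightarrow> q i \<bullet> v = 0"
proof -
  define c where "c i = (if i < r then q i else 0\<^sub>v n)" for i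
  \<comment> \<open>Since \<open>r < n\<close>, row \<open>r\<close> exists and can be set to zero;
    by the choice of \<open>c\<close> the rows after it vanish too.\<close>
  define N where "N = mat\<^sub>r n n (\<lambda>i. if i = r then 0\<^sub>v n else c i)"
  have N: "N \<in> carrier_mat n n" by (simp add: N_def)
  have "det N = 0"
    unfolding N_def using assms by (intro det_row_0) (auto simp: c_def)
  then obtain w where w: "w \<in> carrier_vec n" "w \<noteq> 0\<^sub>v n" "N *\<^sub>v w = 0\<^sub>v n"
    using det_0_iff_vec_prod_zero_field[OF N] by auto
  have qw: "q i \<bullet> w = 0" if i: "i < r" for i
  proof -
    have "(N *\<^sub>v w) $ i = row N i \<bullet> w" using i assms N by simp
    moreover have "row N i = q i" using i assms by (auto simp: N_def c_def intro!: row_mat_of_row_fun)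
    ultimately show ?thesis using w(3) i assms by simp
  qed
  have pos: "w \<bullet> w > 0"
    using scalar_prod_self_pos w by blast
  define a where "a = 1 / sqrt (w \<bullet> w)"
  have "a * a * (w \<bullet> w) = 1" using pos by (simp add: a_def)
  thus ?thesis
    using w q qw by (intro that[of "a \<cdot>\<^sub>v w"]) (auto simp: mult.assoc)
qed


section \<open>Spectral decomposition of symmetric matrices\<close>

lemma sym_mat_scalar_prod:
  fixes M :: "real mat"
  assumes "M \<in> carrier_mat n n" "M\<^sup>T = M" "x \<in> carrier_vec n" "y \<in> carrier_vec n"
  shows "(M *\<^sub>v x) \<bullet> y = x \<bullet> (M *\<^sub>v y)"
  using transpose_vec_mult_scalar[OF assms(1,4,3)] assms(2) by simp

text \<open>For small positive \<open>t\<close> the linear term dominates, so a positive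
  \<open>a\<close> would make the expression positive.\<close>

lemma nonneg_zero_of_quadratic_nonpos:
  fixes a c :: real
  assumes "\<And>t. 2 * t * a + t\<^sup>2 * c \<le> 0" and "0 \<le> a"
  shows "a = 0"
proof (rule ccontr)
  assume "a \<noteq> 0"
  hence a: "a > 0" using assms(2) by simp
  \<comment> \<open>Small enough that \<open>t * \<bar>c\<bar> < a\<close>; adding 1 covers the case
    \<open>c = 0\<close>.\<close>
  define t where "t = a / (\<bar>c\<bar> + 1)"
  have t: "t > 0" "t * (\<bar>c\<bar> + 1) = a" using a by (auto simp: t_def)
  have "t * (2 * a + t * c) \<le> 0"
    using assms(1)[of t] by (simp add: algebra_simps power2_eq_square)
  hence "2 * a + t * c \<le> 0" using t(1) by (simp add: mult_le_0_iff)
  moreover have "- (t * c) \<le> t * \<bar>c\<bar>"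
    using t(1) by (metis abs_ge_minus_self abs_mult abs_of_pos)
  ultimately show False using t a by (simp add: algebra_simps)
qed

text \<open>The first-order condition at a maximizer of the Rayleigh quotient, in the direction of the
  residual \<open>M v - \<mu> v\<close>, says that this residual vanishes.\<close>

lemma rayleigh_maximizer_eigen:
  fixes M :: "real mat" and q :: "nat \<Rightarrow> real vec"
  assumes M: "M \<in> carrier_mat n n" "M\<^sup>T = M"
    and q: "\<And>i. i < r \<Longrightarrow> q i \<in> carrier_vec n" "\<And>i. i < r \<Longrightarrow> M *\<^sub>v q i = d i \<cdot>\<^sub>v q i"
    and v: "v \<in> carrier_vec n" "v \<bullet> v = 1" "\<And>i. i < r \<Longrightarrow> q i \<bullet> v = 0"
    and mx: "\<And>u. u \<in> carrier_vec n \<Longrightarrow> u \<bullet> u = 1 \<Longrightarrow> (\<And>i. i < r \<Longrightarrow> q i \<bullet> u = 0) \<Longrightarrow>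
      u \<bullet> (M *\<^sub>v u) \<le> v \<bullet> (M *\<^sub>v v)"
  shows "M *\<^sub>v v = (v \<bullet> (M *\<^sub>v v)) \<cdot>\<^sub>v v"
proof -
  define \<mu> where "\<mu> = v \<bullet> (M *\<^sub>v v)"
  \<comment> \<open>The bound on unit vectors extends to all admissible vectors by
    homogeneity.\<close>
  have scaled: "w \<bullet> (M *\<^sub>v w) \<le> \<mu> * (w \<bullet> w)"
    if w: "w \<in> carrier_vec n" "\<And>i. i < r \<Longrightarrow> q i \<bullet> w = 0" for w
  proof (cases "w = 0\<^sub>v n")
    case True
    thus ?thesis using M by simp
  next
    case False
    hence pos: "w \<bullet> w > 0" using w scalar_prod_self_pos by blast
    define a where "a = 1 / sqrt (w \<bullet> w)"
    have a: "a * a * (w \<bullet> w) = 1" using pos by (simp add: a_def)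
    have Mw: "M *\<^sub>v w \<in> carrier_vec n" using M w by simp
    have "(a \<cdot>\<^sub>v w) \<bullet> (M *\<^sub>v (a \<cdot>\<^sub>v w)) \<le> \<mu>"
      unfolding \<mu>_def using w q a by (intro mx) (auto simp: mult.assoc)
    hence "a * a * (w \<bullet> (M *\<^sub>v w)) \<le> \<mu>"
      using w Mw by (simp add: mult_mat_vec[OF M(1)] mult.assoc)
    thus ?thesis using pos by (simp add: a_def field_simps)
  qed
  define u where "u = M *\<^sub>v v - \<mu> \<cdot>\<^sub>v v"
  have Mv: "M *\<^sub>v v \<in> carrier_vec n" and u: "u \<in> carrier_vec n"
    using M v by (auto simp: u_def)
  have Mu: "M *\<^sub>v u \<in> carrier_vec n" using M u by simp
  \<comment> \<open>As \<open>M\<close> is self-adjoint and \<open>q i\<close> is an eigenvector,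
    the residual is orthogonal to \<open>q i\<close>, so moving \<open>v\<close> along
    \<open>u\<close> respects the constraints.\<close>
  have qu: "q i \<bullet> u = 0" if i: "i < r" for i
  proof -
    have "q i \<bullet> (M *\<^sub>v v) = (M *\<^sub>v q i) \<bullet> v"
      using sym_mat_scalar_prod[OF M q(1)[OF i] v(1)] by simp
    also have "\<dots> = 0" using q i v by simp
    finally show ?thesis
      using q(1)[OF i] v Mv i by (simp add: u_def scalar_prod_minus_distrib[of _ n])
  qed
  have uu: "u \<bullet> u = u \<bullet> (M *\<^sub>v v) - \<mu> * (u \<bullet> v)"
    using scalar_prod_minus_distrib[OF u Mv, of "\<mu> \<cdot>\<^sub>v v"] u v by (simp add: u_def)
  \<comment> \<open>Expanding \<open>scaled\<close> at \<open>v + t u\<close>, the constant terms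
    cancel because \<open>v\<close> is a unit vector with Rayleigh quotient \<open>\<mu>\<close>;
    the linear coefficient is twice \<open>u \<bullet> u\<close>.\<close>
  have "2 * t * (u \<bullet> u) + t\<^sup>2 * (u \<bullet> (M *\<^sub>v u) - \<mu> * (u \<bullet> u)) \<le> 0" for t
  proof -
    define w where "w = v + t \<cdot>\<^sub>v u"
    have w: "w \<in> carrier_vec n" using v u by (simp add: w_def)
    have "M *\<^sub>v w = M *\<^sub>v v + t \<cdot>\<^sub>v (M *\<^sub>v u)"
      unfolding w_def using M v u by (simp add: mult_add_distrib_mat_vec mult_mat_vec)
    moreover have "v \<bullet> (M *\<^sub>v u) = u \<bullet> (M *\<^sub>v v)"
      using sym_mat_scalar_prod[OF M v(1) u] comm_scalar_prod[OF u Mv] by simp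
    moreover have "v \<bullet> u = u \<bullet> v" using comm_scalar_prod v u by blast
    ultimately have "w \<bullet> (M *\<^sub>v w) - \<mu> * (w \<bullet> w) =
      2 * t * (u \<bullet> (M *\<^sub>v v) - \<mu> * (u \<bullet> v)) + t\<^sup>2 * (u \<bullet> (M *\<^sub>v u) - \<mu> * (u \<bullet> u))"
      using v u Mv Mu v(2) \<mu>_def[symmetric]
      by (simp add: w_def scalar_prod_add_distrib[of _ n] add_scalar_prod_distrib[of _ n]
          algebra_simps power2_eq_square)
    moreover have "w \<bullet> (M *\<^sub>v w) \<le> \<mu> * (w \<bullet> w)"
      using w q v u qu by (intro scaled) (auto simp: w_def scalar_prod_add_distrib[of _ n])
    ultimately show ?thesis unfolding uu[symmetric] by linarith
  qed
  moreover have "u \<bullet> u \<ge> 0" by (simp add: scalar_prod_def sum_nonneg)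
  ultimately have "u \<bullet> u = 0" by (rule nonneg_zero_of_quadratic_nonpos)
  hence u0: "u = 0\<^sub>v n" using scalar_prod_self_pos[OF u] by force
  have "(M *\<^sub>v v) $ i = (\<mu> \<cdot>\<^sub>v v) $ i" if "i < n" for i
  proof -
    have "u $ i = (M *\<^sub>v v) $ i - (\<mu> \<cdot>\<^sub>v v) $ i"
      using that v by (simp add: u_def)
    thus ?thesis using that by (simp add: u0)
  qed
  thus ?thesis unfolding \<mu>_def[symmetric] using M v by (intro eq_vecI) auto
qed

text \<open>The third conjunct makes the greedily chosen eigenvalues decrease: each later eigenvector
  competes in the maximization that produced the earlier ones.\<close>

lemma spectral_decreasing:
  fixes M :: "real mat"
  assumes M: "M \<in> carrier_mat n n" "M\<^sup>T = M" and "r \<le> n"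
  shows "\<exists>q d. (\<forall>i<r. q i \<in> carrier_vec n \<and> M *\<^sub>v q i = d i \<cdot>\<^sub>v q i) \<and>
    (\<forall>i<r. \<forall>j<r. q i \<bullet> q j = (if i = j then 1 else 0)) \<and>
    (\<forall>i<r. \<forall>v\<in>carrier_vec n. v \<bullet> v = 1 \<longrightarrow> (\<forall>j<r. q j \<bullet> v = 0) \<longrightarrow> v \<bullet> (M *\<^sub>v v) \<le> d i) \<and>
    (\<forall>j<r. \<forall>i\<le>j. d j \<le> d i)"
  using assms(3)
proof (induction r)
  case 0
  show ?case by simp
next
  case (Suc r)
  obtain q d where q': "\<forall>i<r. q i \<in> carrier_vec n \<and> M *\<^sub>v q i = d i \<cdot>\<^sub>v q i"
    and orth: "\<forall>i<r. \<forall>j<r. q i \<bullet> q j = (if i = j then 1 else 0)"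
    and bnd: "\<forall>i<r. \<forall>v\<in>carrier_vec n. v \<bullet> v = 1 \<longrightarrow> (\<forall>j<r. q j \<bullet> v = 0) \<longrightarrow> v \<bullet> (M *\<^sub>v v) \<le> d i"
    and mono: "\<forall>j<r. \<forall>i\<le>j. d j \<le> d i"
    using Suc.IH[OF Suc_leD[OF Suc.prems]] by blast
  have q: "q i \<in> carrier_vec n" "M *\<^sub>v q i = d i \<cdot>\<^sub>v q i" if "i < r" for i
    using q' that by blast+
  obtain v0 where v0: "v0 \<in> carrier_vec n" "v0 \<bullet> v0 = 1" "\<And>i. i < r \<Longrightarrow> q i \<bullet> v0 = 0"
    using ex_unit_orthogonal[of r n q] Suc.prems q(1) by (metis Suc_le_eq)
  obtain v where v: "v \<in> carrier_vec n" "v \<bullet> v = 1" "\<And>i. i < r \<Longrightarrow> q i \<bullet> v = 0"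
    and mx: "\<And>u. u \<in> carrier_vec n \<Longrightarrow> u \<bullet> u = 1 \<Longrightarrow> (\<And>i. i < r \<Longrightarrow> q i \<bullet> u = 0) \<Longrightarrow>
      u \<bullet> (M *\<^sub>v u) \<le> v \<bullet> (M *\<^sub>v v)"
    by (rule rayleigh_maximizer[where M = M, OF M(1) q(1) v0]) (blast intro: that)+
  have ev: "M *\<^sub>v v = (v \<bullet> (M *\<^sub>v v)) \<cdot>\<^sub>v v"
    by (rule rayleigh_maximizer_eigen[where q = q and r = r and d = d]) (fact M q v mx)+
  have vq: "v \<bullet> q i = 0" if "i < r" for i
    using v(3)[OF that] comm_scalar_prod[OF v(1) q(1)[OF that]] by simp
  have le: "v \<bullet> (M *\<^sub>v v) \<le> d i" if "i < r" for i
    using bnd that v by (metis (no_types))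
  show ?case
  proof (intro exI[of _ "q(r := v)"] exI[of _ "d(r := v \<bullet> (M *\<^sub>v v))"] conjI)
    show "\<forall>i<Suc r. (q(r := v)) i \<in> carrier_vec n \<and>
      M *\<^sub>v (q(r := v)) i = (d(r := v \<bullet> (M *\<^sub>v v))) i \<cdot>\<^sub>v (q(r := v)) i"
      using q v(1) ev by (auto simp: less_Suc_eq)
    show "\<forall>i<Suc r. \<forall>j<Suc r. (q(r := v)) i \<bullet> (q(r := v)) j = (if i = j then 1 else 0)"
      using orth v vq by (auto simp: less_Suc_eq)
    show "\<forall>i<Suc r. \<forall>u\<in>carrier_vec n. u \<bullet> u = 1 \<longrightarrow> (\<forall>j<Suc r. (q(r := v)) j \<bullet> u = 0) \<longrightarrow>
      u \<bullet> (M *\<^sub>v u) \<le> (d(r := v \<bullet> (M *\<^sub>v v))) i"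
    proof (intro allI impI ballI)
      fix i u assume i: "i < Suc r" and u: "u \<in> carrier_vec n" "u \<bullet> u = 1"
        and qu: "\<forall>j<Suc r. (q(r := v)) j \<bullet> u = 0"
      \<comment> \<open>Orthogonality to the extended family includes orthogonality to the old one,
        so \<open>u\<close> competed when \<open>v\<close> was chosen; the bounds for earlier
        indices follow through \<open>le\<close>.\<close>
      have "q j \<bullet> u = 0" if "j < r" for j
        using qu that by (metis fun_upd_other less_Suc_eq nat_neq_iff)
      hence "u \<bullet> (M *\<^sub>v u) \<le> v \<bullet> (M *\<^sub>v v)" using mx u by blast
      thus "u \<bullet> (M *\<^sub>v u) \<le> (d(r := v \<bullet> (M *\<^sub>v v))) i"
        using le[of i] i by (cases "i = r") auto
    qed
    show "\<forall>j<Suc r. \<forall>i\<le>j. (d(r := v \<bullet> (M *\<^sub>v v))) j \<le> (d(r := v \<bullet> (M *\<^sub>v v))) i"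
      using mono le by (auto simp: less_Suc_eq)
  qed
qed


section \<open>Orthonormal matrices, traces and the sorted spectrum\<close>

lemma orthonormal_mats_iff:
  assumes "V \<in> carrier_mat n k"
  shows "V \<in> orthonormal_mats n k \<longleftrightarrow>
    (\<forall>i<k. \<forall>j<k. col V i \<bullet> col V j = (if i = j then 1 else 0))"
proof -
  have VV: "V\<^sup>T * V \<in> carrier_mat k k" using assms by simp
  have entry: "(V\<^sup>T * V) $$ (i, j) = col V i \<bullet> col V j" if "i < k" "j < k" for i j
    using assms that by simp
  show ?thesis
  proof
    assume "V \<in> orthonormal_mats n k"
    thus "\<forall>i<k. \<forall>j<k. col V i \<bullet> col V j = (if i = j then 1 else 0)"
      unfolding orthonormal_mats_def by (auto simp: entry[symmetric])
  next
    assume "\<forall>i<k. \<forall>j<k. col V i \<bullet> col V j = (if i = j then 1 else 0)"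
    hence "V\<^sup>T * V = 1\<^sub>m k" using VV entry by (intro eq_matI) auto
    thus "V \<in> orthonormal_mats n k" using assms by (simp add: orthonormal_mats_def)
  qed
qed

text \<open>Reduces statements about traces to quadratic forms in the single columns.\<close>

lemma mat_trace_sandwich:
  assumes "V \<in> carrier_mat n k" and "M \<in> carrier_mat n n"
  shows "mat_trace (V\<^sup>T * M * V) = (\<Sum>j<k. col V j \<bullet> (M *\<^sub>v col V j))"
proof -
  have "V\<^sup>T * M * V = V\<^sup>T * (M * V)" using assms by simp
  thus ?thesis
    using assms
    by (simp add: mat_trace_def diag_mat_def interv_sum_list_conv_sum_set_nat lessThan_atLeast0
        del: col_mult)
qed

lemma spectral_decomposition_desc:
  fixes M :: "real mat"
  assumes M: "M \<in> carrier_mat n n" "M\<^sup>T = M"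
  obtains Q d where "Q \<in> orthonormal_mats n n" "M * Q = Q * mat_diag n d"
    "\<And>i j. j < n \<Longrightarrow> i \<le> j \<Longrightarrow> d j \<le> (d i :: real)"
proof -
  obtain q d where q: "\<forall>i<n. q i \<in> carrier_vec n \<and> M *\<^sub>v q i = d i \<cdot>\<^sub>v q i"
    and orth: "\<forall>i<n. \<forall>j<n. q i \<bullet> q j = (if i = j then 1 else 0)"
    and mono: "\<forall>j<n. \<forall>i\<le>j. d j \<le> d i"
    using spectral_decreasing[OF M order_refl] by blast
  define Q where "Q = mat n n (\<lambda>(i, j). q j $ i)"
  have Q: "Q \<in> carrier_mat n n" by (simp add: Q_def)
  have col_Q: "col Q j = q j" if "j < n" for j
    using that q by (intro eq_vecI) (auto simp: Q_def)
  show ?thesis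
  proof (rule that)
    show "Q \<in> orthonormal_mats n n"
      using orth by (simp add: orthonormal_mats_iff[OF Q] col_Q)
    show "M * Q = Q * mat_diag n d"
    proof (rule eq_matI)
      fix i j assume "i < dim_row (Q * mat_diag n d)" "j < dim_col (Q * mat_diag n d)"
      hence ij: "i < n" "j < n" using Q by (auto simp: mat_diag_def)
      have "(M * Q) $$ (i, j) = (M *\<^sub>v col Q j) $ i" using ij M Q by simp
      also have "\<dots> = d j * q j $ i" using ij q col_Q
        by (metis carrier_vecD index_smult_vec(1))
      also have "\<dots> = (Q * mat_diag n d) $$ (i, j)"
        using ij Q by (simp add: mat_diag_mult_right[OF Q]) (simp add: Q_def)
      finally show "(M * Q) $$ (i, j) = (Q * mat_diag n d) $$ (i, j)" .
    qed (use M Q in \<open>auto simp: mat_diag_def\<close>)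
  qed (use mono in auto)
qed

lemma orthonormal_square:
  assumes "Q \<in> orthonormal_mats n n"
  shows "Q * Q\<^sup>T = 1\<^sub>m n"
  using assms mat_mult_left_right_inverse[of "Q\<^sup>T" n Q] by (auto simp: orthonormal_mats_def)

text \<open>\<open>M\<close> is similar to the diagonal matrix, so its characteristic polynomial
  splits into the factors given by \<open>d\<close>. A multiset has only one sorted enumeration,
  which fixes the list.\<close>

lemma eigenvalues_desc_eq:
  fixes M :: "real mat"
  assumes M: "M \<in> carrier_mat n n" and Q: "Q \<in> orthonormal_mats n n"
    and MQ: "M * Q = Q * mat_diag n d" and mono: "\<And>i j. j < n \<Longrightarrow> i \<le> j \<Longrightarrow> d j \<le> d i"
  shows "eigenvalues_desc M = map d [0..<n]"
proof -
  have QC: "Q \<in> carrier_mat n n" and QTQ: "Q\<^sup>T * Q = 1\<^sub>m n"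
    using Q by (auto simp: orthonormal_mats_def)
  have D: "mat_diag n d \<in> carrier_mat n n" by simp
  have "M = M * (Q * Q\<^sup>T)" using M orthonormal_square[OF Q] by simp
  also have "\<dots> = Q * mat_diag n d * Q\<^sup>T"
    using M QC MQ assoc_mult_mat[of M n n Q n "Q\<^sup>T" n] by simp
  finally have "M = Q * mat_diag n d * Q\<^sup>T" .
  hence "similar_mat M (mat_diag n d)"
    using M QC D QTQ orthonormal_square[OF Q]
    by (intro similar_matI[of _ _ Q "Q\<^sup>T" n]) (simp_all del: assoc_mult_mat)
  hence "char_poly M = char_poly (mat_diag n d)" by (rule char_poly_similar)
  also have "\<dots> = (\<Prod>a\<leftarrow>diag_mat (mat_diag n d). [:- a, 1:])"
    using D by (rule char_poly_upper_triangular) (auto simp: mat_diag_def upper_triangular_def)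
  also have "diag_mat (mat_diag n d) = map d [0..<n]"
    by (auto simp: diag_mat_def mat_diag_def)
  finally have cp: "char_poly M = (\<Prod>a\<leftarrow>map d [0..<n]. [:- a, 1:])" .
  have linear_factors: "proots (\<Prod>a\<leftarrow>xs. [:- a, 1:]) = mset xs" for xs :: "real list"
  proof (induction xs)
    case (Cons a xs)
    have "(\<Prod>a\<leftarrow>xs. [:- a, 1:]) \<noteq> 0" by (auto simp: prod_list_zero_iff)
    thus ?case using Cons by (simp add: proots_mult del: mult_pCons_left)
  qed simp
  \<comment> \<open>The list is reversed because \<open>eigenvalues_desc\<close> sorts in ascending
    order first.\<close>
  have "proots (char_poly M) = mset (rev (map d [0..<n]))"
    unfolding cp linear_factors by simp
  moreover have "sorted (rev (map d [0..<n]))"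
    using mono by (auto simp: sorted_rev_iff_nth_mono)
  ultimately show ?thesis
    unfolding eigenvalues_desc_def
    by (metis sorted_list_of_multiset_mset sorted_sort_id rev_rev_ident)
qed


section \<open>Ky Fan's inequality\<close>

text \<open>With side conditions on dimensions alone, rewriting need not guess any carrier
  sizes.\<close>

lemma assoc_mult_mat_dim:
  fixes A B C :: "'a :: semiring_0 mat"
  assumes "dim_col A = dim_row B" and "dim_col B = dim_row C"
  shows "A * B * C = A * (B * C)"
  by (rule assoc_mult_mat) (use assms in \<open>auto intro: carrier_matI\<close>)

text \<open>The matrix \<open>P = W * W\<^sup>T\<close> is an orthogonal projection. Symmetry and
  idempotence make each diagonal entry the sum of the squares in its row, hence at least its own
  square and so at most 1. The diagonal entries are the squared row norms of
  \<open>W\<close>.\<close>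

lemma orthonormal_row_norm_le_1:
  assumes "W \<in> orthonormal_mats n k" and i: "i < n"
  shows "(\<Sum>j<k. (W $$ (i, j))\<^sup>2) \<le> 1"
proof -
  have W: "W \<in> carrier_mat n k" and WTW: "W\<^sup>T * W = 1\<^sub>m k"
    using assms by (auto simp: orthonormal_mats_def)
  define P where "P = W * W\<^sup>T"
  have P: "P \<in> carrier_mat n n" using W by (simp add: P_def)
  have entry: "P $$ (a, b) = row W a \<bullet> row W b" if "a < n" "b < n" for a b
    using that W by (simp add: P_def)
  have sym: "P $$ (a, b) = P $$ (b, a)" if "a < n" "b < n" for a b
    using entry that W comm_scalar_prod[of "row W a" k "row W b"] by auto
  have "P * P = W * (W\<^sup>T * W) * W\<^sup>T"
    using W unfolding P_def by (simp add: assoc_mult_mat_dim del: assoc_mult_mat)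
  hence idem: "P * P = P" using W by (simp add: WTW P_def)
  have "(P $$ (i, i))\<^sup>2 \<le> (\<Sum>l<n. (P $$ (i, l))\<^sup>2)"
    using i by (intro member_le_sum) auto
  also have "\<dots> = (\<Sum>l<n. P $$ (i, l) * P $$ (l, i))"
    using sym i by (intro sum.cong) (auto simp: power2_eq_square)
  also have "\<dots> = (P * P) $$ (i, i)"
    using P i by (simp add: scalar_prod_def lessThan_atLeast0)
  also have "\<dots> = P $$ (i, i)"
    by (simp only: idem)
  finally have "P $$ (i, i) * P $$ (i, i) \<le> P $$ (i, i)"
    by (simp only: power2_eq_square)
  hence "P $$ (i, i) \<le> 1"
    using mult_strict_right_mono[of 1 "P $$ (i, i)" "P $$ (i, i)"] by linarith
  moreover have "P $$ (i, i) = (\<Sum>j<k. (W $$ (i, j))\<^sup>2)"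
    using entry[OF i i] W i by (simp add: scalar_prod_def power2_eq_square lessThan_atLeast0)
  ultimately show ?thesis by simp
qed

text \<open>Subtract the threshold \<open>c\<close>, the smallest leading value: weights on
  nonnegative differences are best raised to 1, the others lowered to 0. The total weight is
  \<open>k\<close>, so the shift changes both sides by the same amount.\<close>

lemma weighted_sum_le_leading_sum:
  fixes d w :: "nat \<Rightarrow> real"
  assumes mono: "\<And>i j. j < n \<Longrightarrow> i \<le> j \<Longrightarrow> d j \<le> d i" and k: "0 < k" "k \<le> n"
    and w: "\<And>i. i < n \<Longrightarrow> 0 \<le> w i" "\<And>i. i < n \<Longrightarrow> w i \<le> 1" and sum_w: "(\<Sum>i<n. w i) = real k"
  shows "(\<Sum>i<n. d i * w i) \<le> (\<Sum>i<k. d i)"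
proof -
  \<comment> \<open>Index \<open>k - 1\<close> is the last of the \<open>k\<close> leading ones;
    \<open>0 < k\<close> rules out truncated subtraction.\<close>
  define c where "c = d (k - 1)"
  have "(d i - c) * w i \<le> (if i < k then d i - c else 0)" if i: "i < n" for i
  proof (cases "i < k")
    case True
    hence "d i - c \<ge> 0" using mono[of "k - 1" i] k by (simp add: c_def)
    thus ?thesis using True mult_left_le[OF w(2)[OF i]] by simp
  next
    case False
    hence "d i - c \<le> 0" using mono[OF i, of "k - 1"] by (simp add: c_def)
    thus ?thesis using False w(1)[OF i] by (simp add: mult_nonpos_nonneg)
  qed
  hence "(\<Sum>i<n. (d i - c) * w i) \<le> (\<Sum>i<n. if i < k then d i - c else 0)"
    by (intro sum_mono) auto
  also have "\<dots> = (\<Sum>i<k. d i - c)"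
    using k by (intro sum.mono_neutral_cong_right) auto
  finally show ?thesis
    by (simp add: left_diff_distrib sum_subtractf sum_w flip: sum_distrib_left)
qed

text \<open>In an orthonormal eigenbasis the trace is the sum of the eigenvalues weighted by the
  squared row norms of \<open>W = Q\<^sup>T * Y\<close>. These weights lie between 0 and 1 and add
  up to \<open>k\<close>, so the weighted sum is at most that of the \<open>k\<close> largest
  eigenvalues.\<close>

theorem ky_fan_le:
  fixes M :: "real mat"
  assumes M: "M \<in> carrier_mat n n" "M\<^sup>T = M" and k: "0 < k" "k \<le> n"
    and Y: "Y \<in> orthonormal_mats n k"
  shows "mat_trace (Y\<^sup>T * M * Y) \<le> sum_list (take k (eigenvalues_desc M))"
proof -
  obtain Q d where Q: "Q \<in> orthonormal_mats n n" and MQ: "M * Q = Q * mat_diag n d"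
    and mono: "\<And>i j. j < n \<Longrightarrow> i \<le> j \<Longrightarrow> d j \<le> (d i :: real)"
    using spectral_decomposition_desc[OF M] by blast
  have QC: "Q \<in> carrier_mat n n" and QTQ: "Q\<^sup>T * Q = 1\<^sub>m n"
    and YC: "Y \<in> carrier_mat n k" and YTY: "Y\<^sup>T * Y = 1\<^sub>m k"
    using Q Y by (auto simp: orthonormal_mats_def)
  have D: "mat_diag n d \<in> carrier_mat n n" by simp
  define W where "W = Q\<^sup>T * Y"
  have WC: "W \<in> carrier_mat n k" using QC YC by (simp add: W_def)
  have "Q * W = Q * Q\<^sup>T * Y" unfolding W_def using QC YC by simp
  hence QW: "Y = Q * W" using orthonormal_square[OF Q] YC by simp
  have QTM: "Q\<^sup>T * (M * Q) = mat_diag n d"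
  proof -
    have "Q\<^sup>T * (M * Q) = Q\<^sup>T * Q * mat_diag n d"
      unfolding MQ using QC D by (metis assoc_mult_mat transpose_carrier_mat)
    thus ?thesis using D by (simp add: QTQ)
  qed
  have "W\<^sup>T * W = Y\<^sup>T * (Q * W)"
    unfolding W_def using QC YC
    by (simp add: transpose_mult[of _ n n _ k] assoc_mult_mat_dim del: assoc_mult_mat)
  hence W: "W \<in> orthonormal_mats n k"
    using WC by (simp add: orthonormal_mats_def YTY flip: QW)
  have "Y\<^sup>T * M * Y = W\<^sup>T * (Q\<^sup>T * (M * Q)) * W"
    unfolding QW using QC WC M(1)
    by (simp add: transpose_mult[of _ n n _ k] assoc_mult_mat_dim del: assoc_mult_mat)
  hence "mat_trace (Y\<^sup>T * M * Y) = (\<Sum>j<k. col W j \<bullet> (mat_diag n d *\<^sub>v col W j))"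
    by (simp only: QTM mat_trace_sandwich[OF WC D])
  also have "\<dots> = (\<Sum>j<k. \<Sum>i<n. d i * (W $$ (i, j))\<^sup>2)"
  proof (intro sum.cong refl)
    fix j assume "j \<in> {..<k}"
    hence j: "j < k" by simp
    have "(mat_diag n d *\<^sub>v col W j) $ i = d i * W $$ (i, j)" if i: "i < n" for i
    proof -
      have "(mat_diag n d *\<^sub>v col W j) $ i = (mat_diag n d * W) $$ (i, j)"
        using i j WC by (simp add: carrier_matD[OF D])
      thus ?thesis using i j by (simp add: mat_diag_mult_left[OF WC])
    qed
    thus "col W j \<bullet> (mat_diag n d *\<^sub>v col W j) = (\<Sum>i<n. d i * (W $$ (i, j))\<^sup>2)"
      using WC j unfolding scalar_prod_def
      by (auto simp: lessThan_atLeast0 power2_eq_square carrier_matD[OF D]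
          simp del: index_mult_mat_vec intro!: sum.cong)
  qed
  also have "\<dots> = (\<Sum>i<n. d i * (\<Sum>j<k. (W $$ (i, j))\<^sup>2))"
    by (subst sum.swap) (simp add: sum_distrib_left)
  also have "\<dots> \<le> (\<Sum>i<k. d i)"
  proof (rule weighted_sum_le_leading_sum[OF _ k])
    show "d j \<le> d i" if "j < n" "i \<le> j" for i j
      using that by (rule mono)
    show "0 \<le> (\<Sum>j<k. (W $$ (i, j))\<^sup>2)" for i
      by (simp add: sum_nonneg)
    show "(\<Sum>j<k. (W $$ (i, j))\<^sup>2) \<le> 1" if "i < n" for i
      using W that by (rule orthonormal_row_norm_le_1)
    \<comment> \<open>The total weight is counted by columns instead: \<open>W\<close> has
      \<open>k\<close> unit columns.\<close>
    have "(\<Sum>i<n. \<Sum>j<k. (W $$ (i, j))\<^sup>2) = (\<Sum>j<k. \<Sum>i<n. (W $$ (i, j))\<^sup>2)"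
      by (rule sum.swap)
    also have "\<dots> = (\<Sum>j<k. col W j \<bullet> col W j)"
      using WC by (intro sum.cong) (auto simp: scalar_prod_def power2_eq_square lessThan_atLeast0)
    also have "\<dots> = real k"
      using W orthonormal_mats_iff[OF WC] by simp
    finally show "(\<Sum>i<n. \<Sum>j<k. (W $$ (i, j))\<^sup>2) = real k" .
  qed
  also have "\<dots> = sum_list (take k (eigenvalues_desc M))"
    using k by (simp add: eigenvalues_desc_eq[OF M(1) Q MQ mono] take_map
        interv_sum_list_conv_sum_set_nat lessThan_atLeast0)
  finally show ?thesis .
qed

text \<open>Each unit eigenvector contributes its eigenvalue, and the order of the columns does not
  affect the sum. For the leading eigenvalues this is the equality case of
  \<open>ky_fan_le\<close>.\<close>

lemma mat_trace_eigenvector_cols: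
  fixes M :: "real mat"
  assumes M: "M \<in> carrier_mat n n" and Z: "Z \<in> orthonormal_mats n k"
    and ev: "eigenvector_cols M Z es"
  shows "mat_trace (Z\<^sup>T * M * Z) = sum_list es"
proof -
  have ZC: "Z \<in> carrier_mat n k" using Z by (simp add: orthonormal_mats_def)
  obtain ds where ds: "mset ds = mset es" "list_all2 (eigenvector M) (cols Z) ds"
    using ev unfolding eigenvector_cols_def by blast
  have len: "length ds = k" using ds(2) ZC by (auto dest: list_all2_lengthD)
  have "col Z j \<bullet> (M *\<^sub>v col Z j) = ds ! j" if j: "j < k" for j
  proof -
    have "eigenvector M (col Z j) (ds ! j)"
      using list_all2_nthD[OF ds(2), of j] j ZC by simp
    moreover have "col Z j \<bullet> col Z j = 1" using Z orthonormal_mats_iff[OF ZC] j by simp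
    moreover have "col Z j \<in> carrier_vec n" using ZC j by simp
    ultimately show ?thesis by (simp add: eigenvector_def)
  qed
  hence "mat_trace (Z\<^sup>T * M * Z) = (\<Sum>j<k. ds ! j)"
    by (simp add: mat_trace_sandwich[OF ZC M])
  also have "\<dots> = sum_list ds" by (simp add: sum_list_sum_nth len lessThan_atLeast0)
  also have "\<dots> = sum_list es" using ds(1) by (metis sum_mset_sum_list)
  finally show ?thesis .
qed

section \<open>The trace ratio on a subspace\<close>

lemma orthonormal_mats_mult:
  assumes "U \<in> orthonormal_mats p m" and "Y \<in> orthonormal_mats m k"
  shows "U * Y \<in> orthonormal_mats p k"
proof -
  have C: "U \<in> carrier_mat p m" "Y \<in> carrier_mat m k" using assms by (auto simp: orthonormal_mats_def)
  have "(U * Y)\<^sup>T * (U * Y) = Y\<^sup>T * (U\<^sup>T * U) * Y"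
    using C by (simp add: transpose_mult[OF C] assoc_mult_mat_dim del: assoc_mult_mat)
  also have "\<dots> = 1\<^sub>m k" using assms C by (simp add: orthonormal_mats_def)
  finally show ?thesis using C by (simp add: orthonormal_mats_def)
qed

lemma mem_col_span_iff:
  assumes "U \<in> carrier_mat p m"
  shows "y \<in> col_span p U \<longleftrightarrow> (\<exists>x\<in>carrier_vec m. y = U *\<^sub>v x)"
  using assms vec_space.col_space_eq[OF assms] by auto

lemma col_span_mult_subset:
  assumes "U \<in> carrier_mat p m" and "Y \<in> carrier_mat m k"
  shows "col_span p (U * Y) \<subseteq> col_span p U"
proof
  fix y assume "y \<in> col_span p (U * Y)"
  then obtain x where x: "x \<in> carrier_vec k" "y = U * Y *\<^sub>v x"
    using mem_col_span_iff[of "U * Y" p k] assms by auto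
  hence "y = U *\<^sub>v (Y *\<^sub>v x)" using assms by simp
  thus "y \<in> col_span p U"
    unfolding mem_col_span_iff[OF assms(1)] using assms(2) x(1) mult_mat_vec_carrier by blast
qed

text \<open>\<open>U\<close> maps coordinates isometrically onto its column span, with
  \<open>U\<^sup>T\<close> as inverse there. The maximization over a subspace thus becomes one over
  all orthonormal coordinate matrices.\<close>

lemma orthonormal_mats_in_col_span:
  assumes U: "U \<in> orthonormal_mats p m"
  shows "orthonormal_mats_in p k (col_span p U) = (*) U ` orthonormal_mats m k"
proof (intro equalityI subsetI)
  have UC: "U \<in> carrier_mat p m" and UTU: "U\<^sup>T * U = 1\<^sub>m m"
    using U by (auto simp: orthonormal_mats_def)
  fix V
  {
    assume V: "V \<in> orthonormal_mats_in p k (col_span p U)"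
    hence VC: "V \<in> carrier_mat p k" and VTV: "V\<^sup>T * V = 1\<^sub>m k" and sub: "set (cols V) \<subseteq> col_span p U"
      by (auto simp: orthonormal_mats_in_def orthonormal_mats_def)
    define Y where "Y = U\<^sup>T * V"
    have YC: "Y \<in> carrier_mat m k" using UC VC by (simp add: Y_def)
    have "col (U * Y) j = col V j" if j: "j < k" for j
    proof -
      have "col V j \<in> set (cols V)" using j VC by (simp add: cols_def)
      then obtain x where x: "x \<in> carrier_vec m" "col V j = U *\<^sub>v x"
        using sub mem_col_span_iff[OF UC] by blast
      \<comment> \<open>\<open>U * U\<^sup>T\<close> fixes every vector of the column span, since
        \<open>U\<^sup>T * U\<close> is the identity.\<close>
      have "col (U * Y) j = U *\<^sub>v (U\<^sup>T *\<^sub>v col V j)"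
        using j UC YC VC by (simp add: Y_def col_mult2[of _ p m _ k] del: col_mult)
      also have "\<dots> = U *\<^sub>v (U\<^sup>T * U *\<^sub>v x)" using x UC by simp
      finally show ?thesis using x by (simp add: UTU)
    qed
    hence UY: "U * Y = V" using UC YC VC by (intro mat_col_eqI) auto
    have "Y\<^sup>T * Y = V\<^sup>T * (U * Y)"
      unfolding Y_def using UC VC
      by (simp add: transpose_mult[of _ m p _ k] assoc_mult_mat_dim del: assoc_mult_mat)
    hence "Y \<in> orthonormal_mats m k" using YC VTV UY by (simp add: orthonormal_mats_def)
    thus "V \<in> (*) U ` orthonormal_mats m k" using UY by blast
  next
    assume "V \<in> (*) U ` orthonormal_mats m k"
    then obtain Y where Y: "Y \<in> orthonormal_mats m k" "V = U * Y" by blast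
    hence YC: "Y \<in> carrier_mat m k" by (simp add: orthonormal_mats_def)
    have "col V j \<in> col_span p U" if "j < k" for j
      using that Y(2) UC YC mem_col_span_iff[OF UC] by (metis col_carrier_vec col_mult2)
    hence "set (cols V) \<subseteq> col_span p U" using Y(2) YC by (auto simp: cols_def)
    thus "V \<in> orthonormal_mats_in p k (col_span p U)"
      using orthonormal_mats_mult[OF U Y(1)] Y(2) by (simp add: orthonormal_mats_in_def)
  }
qed

section \<open>Compression of the quadratic forms and attainment of the maximal ratio\<close>

lemma compress_sandwich:
  fixes U Y A :: "real mat"
  assumes "U \<in> carrier_mat p m" and "Y \<in> carrier_mat m k" and "A \<in> carrier_mat p p"
  shows "(U * Y)\<^sup>T * A * (U * Y) = Y\<^sup>T * (U\<^sup>T * A * U) * Y"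
  using assms by (simp add: transpose_mult[OF assms(1,2)] assoc_mult_mat_dim del: assoc_mult_mat)

lemma mat_trace_pos:
  assumes "positive_definite p B" and "B \<in> carrier_mat p p" and V: "V \<in> orthonormal_mats p k" and "0 < k"
  shows "mat_trace (V\<^sup>T * B * V) > 0"
proof -
  have VC: "V \<in> carrier_mat p k" using V by (simp add: orthonormal_mats_def)
  have "col V j \<bullet> (B *\<^sub>v col V j) > 0" if j: "j < k" for j
  proof -
    have c: "col V j \<in> carrier_vec p" using VC j by simp
    have "col V j \<bullet> col V j = 1" using V orthonormal_mats_iff[OF VC] j by simp
    hence "col V j \<noteq> 0\<^sub>v p" using c by auto
    thus ?thesis using assms(1) c by (simp add: positive_definite_def)
  qed
  thus ?thesis
    unfolding mat_trace_sandwich[OF VC assms(2)] using \<open>0 < k\<close> by (intro sum_pos) auto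
qed

text \<open>Orthonormality is a closed condition and bounds all entries by 1, so the admissible
  matrices can be encoded in a compact set. The positive denominator makes the ratio continuous
  there.\<close>

lemma trace_ratio_attains_max:
  assumes H: "H \<in> carrier_mat m m" and K: "K \<in> carrier_mat m m"
    and pos: "\<And>Y. Y \<in> orthonormal_mats m k \<Longrightarrow> mat_trace (Y\<^sup>T * K * Y) > 0"
    and Y0: "Y0 \<in> orthonormal_mats m k"
  obtains Y where "Y \<in> orthonormal_mats m k"
    "\<And>Y'. Y' \<in> orthonormal_mats m k \<Longrightarrow> trace_ratio H K Y' \<le> trace_ratio H K Y"
proof -
  define C where "C = {x :: nat \<times> nat \<Rightarrow> real. \<forall>i\<in>{..<k}. \<forall>j\<in>{..<k}.
    col (mat m k x) i \<bullet> col (mat m k x) j = (if i = j then 1 else 0)}"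
  define S where "S = {x \<in> C. \<forall>i. \<bar>x i\<bar> \<le> 1}"
  define ext where "ext Y = (\<lambda>(i, j). if i < m \<and> j < k then Y $$ (i, j) else 0)" for Y :: "real mat"
  have C_iff: "x \<in> C \<longleftrightarrow> mat m k x \<in> orthonormal_mats m k" for x
    by (simp add: C_def orthonormal_mats_iff[of _ m k] Ball_def del: col_mat)
  have mat_ext: "mat m k (ext Y) = Y" if "Y \<in> orthonormal_mats m k" for Y
    using that by (intro eq_matI) (auto simp: ext_def orthonormal_mats_def)
  have ext: "ext Y \<in> S" if Y: "Y \<in> orthonormal_mats m k" for Y
  proof -
    have YC: "Y \<in> carrier_mat m k" using Y by (simp add: orthonormal_mats_def)
    have "\<bar>Y $$ (i, j)\<bar> \<le> 1" if "i < m" "j < k" for i j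
      using unit_vec_index_abs_le[of "col Y j" i] Y YC that orthonormal_mats_iff[OF YC] by auto
    hence "\<forall>i. \<bar>ext Y i\<bar> \<le> 1" by (auto simp: ext_def)
    thus ?thesis by (simp add: S_def C_iff mat_ext[OF Y] Y)
  qed
  have trace_cont: "continuous_on S (\<lambda>x. mat_trace ((mat m k x)\<^sup>T * N * mat m k x))"
    if N: "N \<in> carrier_mat m m" for N
  proof -
    \<comment> \<open>Written out in coordinates the trace is a polynomial in the entries of
      \<open>x\<close>, hence continuous.\<close>
    have "mat_trace ((mat m k x)\<^sup>T * N * mat m k x) =
      (\<Sum>j<k. \<Sum>a<m. x (a, j) * (\<Sum>b<m. N $$ (a, b) * x (b, j)))" for x
      unfolding mat_trace_sandwich[OF mat_carrier N] using N
      by (intro sum.cong) (auto simp: scalar_prod_def lessThan_atLeast0)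
    thus ?thesis
      by (simp only:) (intro continuous_intros
          continuous_on_subset[OF continuous_on_product_coordinates subset_UNIV])
  qed
  have "closed C"
    unfolding C_def
    by (intro closed_Collect_ball closed_Collect_eq)
      (auto simp: scalar_prod_def intro!: continuous_intros)
  moreover have "continuous_on S (\<lambda>x. trace_ratio H K (mat m k x))"
    unfolding trace_ratio_def
    using trace_cont[OF H] trace_cont[OF K] pos
    by (intro continuous_on_divide) (auto simp: S_def C_iff less_le)
  ultimately obtain x where x: "x \<in> S"
    and mx: "\<forall>y\<in>S. trace_ratio H K (mat m k y) \<le> trace_ratio H K (mat m k x)"
    using attains_max_in_cube[of C "ext Y0" "\<lambda>x. trace_ratio H K (mat m k x)"] ext[OF Y0]
    unfolding S_def by auto
  show ?thesis
  proof (rule that[of "mat m k x"])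
    show "trace_ratio H K Y' \<le> trace_ratio H K (mat m k x)" if "Y' \<in> orthonormal_mats m k" for Y'
      using mx ext[OF that] mat_ext[OF that] by metis
  qed (use x in \<open>auto simp: S_def C_iff\<close>)
qed

text \<open>Connects the ratio with the parametric difference \<open>H - c K\<close>: comparing the
  ratio with \<open>c\<close> amounts to finding the sign of this trace when the denominator is
  positive.\<close>

lemma mat_trace_sandwich_diff:
  assumes Y: "Y \<in> carrier_mat m k" and H: "H \<in> carrier_mat m m" and K: "K \<in> carrier_mat m m"
  shows "mat_trace (Y\<^sup>T * (H - c \<cdot>\<^sub>m K) * Y) = mat_trace (Y\<^sup>T * H * Y) - c * mat_trace (Y\<^sup>T * K * Y)"
proof -
  have M: "H - c \<cdot>\<^sub>m K \<in> carrier_mat m m" using K by (intro minus_carrier_mat) simp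
  have "y \<bullet> ((H - c \<cdot>\<^sub>m K) *\<^sub>v y) = y \<bullet> (H *\<^sub>v y) - c * (y \<bullet> (K *\<^sub>v y))"
    if y: "y \<in> carrier_vec m" for y
  proof -
    have "(H - c \<cdot>\<^sub>m K) *\<^sub>v y = H *\<^sub>v y - c \<cdot>\<^sub>v (K *\<^sub>v y)"
      using y H K by (intro eq_vecI)
        (auto simp: scalar_prod_def left_diff_distrib sum_subtractf sum_distrib_left mult.assoc)
    moreover have "H *\<^sub>v y \<in> carrier_vec m" "K *\<^sub>v y \<in> carrier_vec m" using H K y by auto
    ultimately show ?thesis using y by (simp add: scalar_prod_minus_distrib[of _ m])
  qed
  thus ?thesis
    using Y by (simp add: mat_trace_sandwich[OF Y] H K M sum_subtractf sum_distrib_left)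
qed

lemma col_append_columns_left:
  assumes "Z \<in> carrier_mat m k" and "Z' \<in> carrier_mat m l" and "j < k"
  shows "col (append_columns Z Z') j = col Z j"
  using assms by (simp add: append_columns_def nth_append)

lemma transpose_compress:
  fixes U A :: "real mat"
  assumes "U \<in> carrier_mat p m" and "A \<in> carrier_mat p p" and "A\<^sup>T = A"
  shows "(U\<^sup>T * A * U)\<^sup>T = U\<^sup>T * A * U"
  using assms by (simp add: transpose_mult[of _ m p _ m] transpose_mult[of _ p p _ m])

theorem mainTheorem2:
  fixes A B U2 H K Z Z' Z1 U1 :: "real mat"
    and p k m1 m2 :: nat
    and \<rho> :: real
  assumes "A \<in> carrier_mat p p" and "A\<^sup>T = A"
    and "B \<in> carrier_mat p p" and "B\<^sup>T = B" and "positive_definite p B"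
    and "0 < k" and "k \<le> m1" and "m1 < m2" and "m2 \<le> p"
    and "U2 \<in> orthonormal_mats p m2"
    and "H = U2\<^sup>T * A * U2"
    and "K = U2\<^sup>T * B * U2"
    and "\<rho> = (GREATEST r. r \<in> trace_ratio A B ` orthonormal_mats_in p k (col_span p U2))"
    and "Z \<in> carrier_mat m2 k" and "Z' \<in> carrier_mat m2 (m1 - k)"
    and "Z1 = append_columns Z Z'"
    and "Z1 \<in> orthonormal_mats m2 m1"
    and "eigenvector_cols (H - \<rho> \<cdot>\<^sub>m K) Z
           (take k (eigenvalues_desc (H - \<rho> \<cdot>\<^sub>m K)))"
    and "eigenvector_cols (H - \<rho> \<cdot>\<^sub>m K) Z'
           (take (m1 - k) (drop k (eigenvalues_desc (H - \<rho> \<cdot>\<^sub>m K))))"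
    and "U1 = U2 * Z1"
  shows "is_maximum (trace_ratio A B ` orthonormal_mats_in p k (col_span p U2)) \<rho>
    \<and> is_maximum (trace_ratio H K ` orthonormal_mats m2 k) \<rho>
    \<and> is_arg_max (trace_ratio H K) (\<lambda>Y. Y \<in> orthonormal_mats m2 k) Z
    \<and> col_span p U1 \<subseteq> col_span p U2
    \<and> is_maximum (trace_ratio A B ` orthonormal_mats_in p k (col_span p U1)) \<rho>
    \<and> is_arg_max (trace_ratio A B) (\<lambda>V. V \<in> orthonormal_mats_in p k (col_span p U1)) (U2 * Z)"
proof -
  let ?O = "orthonormal_mats m2 k"
  let ?f = "trace_ratio H K"
  have UC: "U2 \<in> carrier_mat p m2" using assms(10) by (simp add: orthonormal_mats_def)
  have HC: "H \<in> carrier_mat m2 m2" and KC: "K \<in> carrier_mat m2 m2"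
    using UC assms(1,3,11,12) by auto
  have HT: "H\<^sup>T = H" and KT: "K\<^sup>T = K"
    unfolding assms(11,12) using transpose_compress UC assms(1-4) by blast+
  define M where "M = H - \<rho> \<cdot>\<^sub>m K"
  have MC: "M \<in> carrier_mat m2 m2" unfolding M_def using KC by (intro minus_carrier_mat) simp
  have MT: "M\<^sup>T = M" 
  proof (rule eq_matI)
    fix i j assume "i < dim_row M" "j < dim_col M"
    hence ij: "i < m2" "j < m2" using MC by auto
    have "H $$ (j, i) = H $$ (i, j)" "K $$ (j, i) = K $$ (i, j)"
      using ij HC KC HT KT by (metis carrier_matD index_transpose_mat(1))+
    thus "M\<^sup>T $$ (i, j) = M $$ (i, j)" using ij HC KC by (simp add: M_def)
  qed (use MC in auto)
  have O_carrier: "Y \<in> carrier_mat m2 k" if "Y \<in> ?O" for Y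
    using that by (simp add: orthonormal_mats_def)
  have ratio: "trace_ratio A B (U2 * Y) = ?f Y" if "Y \<in> ?O" for Y
    unfolding trace_ratio_def assms(11,12)
    by (simp only: compress_sandwich[OF UC O_carrier[OF that] assms(1)]
        compress_sandwich[OF UC O_carrier[OF that] assms(3)])
  have image: "trace_ratio A B ` orthonormal_mats_in p k (col_span p U2) = ?f ` ?O"
    unfolding orthonormal_mats_in_col_span[OF assms(10)] image_image using ratio by auto
  have pos: "mat_trace (Y\<^sup>T * K * Y) > 0" if Y: "Y \<in> ?O" for Y
  proof -
    have "Y\<^sup>T * K * Y = (U2 * Y)\<^sup>T * B * (U2 * Y)"
      unfolding assms(12) by (rule compress_sandwich[OF UC O_carrier[OF Y] assms(3), symmetric])
    thus ?thesis
      using mat_trace_pos[OF assms(5,3) orthonormal_mats_mult[OF assms(10) Y] assms(6)] by simp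
  qed
  have Z1C: "Z1 \<in> carrier_mat m2 m1" using assms(17) by (simp add: orthonormal_mats_def)
  have col_Z1: "col Z1 j = col Z j" if "j < k" for j
    unfolding assms(16) using assms(14,15) that by (rule col_append_columns_left)
  \<comment> \<open>The columns of \<open>Z\<close> are the first \<open>k\<close> columns of
    \<open>Z1\<close> and inherit orthonormality.\<close>
  have Z: "Z \<in> ?O"
    using assms(7,17) orthonormal_mats_iff[OF Z1C] by (simp add: orthonormal_mats_iff[OF assms(14)] flip: col_Z1)
  obtain Y where Y: "Y \<in> ?O" and Y_max: "\<And>Y'. Y' \<in> ?O \<Longrightarrow> ?f Y' \<le> ?f Y"
    using trace_ratio_attains_max[OF HC KC pos Z] by blast
  \<comment> \<open>\<open>GREATEST\<close> denotes the maximum because \<open>Y\<close> attains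
    it.\<close>
  have "\<rho> = ?f Y"
    unfolding assms(13) image using Y Y_max by (intro Greatest_equality) auto
  hence max: "is_maximum (?f ` ?O) \<rho>"
    using Y Y_max by (auto simp: is_maximum_def)
  \<comment> \<open>The second factor is positive, so the trace has the sign of
    \<open>?f W - \<rho>\<close>.\<close>
  have trace_M: "mat_trace (W\<^sup>T * M * W) = (?f W - \<rho>) * mat_trace (W\<^sup>T * K * W)" if W: "W \<in> ?O" for W
    unfolding M_def trace_ratio_def left_diff_distrib using mat_trace_sandwich_diff[OF O_carrier[OF W] HC KC, of \<rho>] pos[OF W]
    by simp
  \<comment> \<open>Ky Fan's inequality is applied to the maximizer \<open>Y\<close>, where the
    trace vanishes; its bound is the trace at \<open>Z\<close>, which is therefore
    nonnegative.\<close>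
  have "0 = mat_trace (Y\<^sup>T * M * Y)"
    using trace_M[OF Y] \<open>\<rho> = ?f Y\<close> by simp
  also have "\<dots> \<le> sum_list (take k (eigenvalues_desc M))"
    using ky_fan_le[OF MC MT assms(6) _ Y] assms(7,8) by simp
  also have "\<dots> = mat_trace (Z\<^sup>T * M * Z)"
    using mat_trace_eigenvector_cols[OF MC Z] assms(18) by (simp add: M_def)
  finally have "\<rho> \<le> ?f Z"
    using trace_M[OF Z] pos[OF Z] by (simp add: zero_le_mult_iff)
  hence f_Z: "?f Z = \<rho>" using Y_max[OF Z] \<open>\<rho> = ?f Y\<close> by simp
  have sub: "col_span p U1 \<subseteq> col_span p U2"
    unfolding assms(20) using UC Z1C by (rule col_span_mult_subset)
  have in_sub: "orthonormal_mats_in p k (col_span p U1) \<subseteq> orthonormal_mats_in p k (col_span p U2)"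
    using sub by (auto simp: orthonormal_mats_in_def)
  have U1C: "U1 \<in> carrier_mat p m1" using UC Z1C by (simp add: assms(20))
  \<comment> \<open>Column \<open>j\<close> of \<open>U2 * Z\<close> is also column \<open>j\<close>
    of \<open>U1\<close>, that is, \<open>U1\<close> applied to a unit vector.\<close>
  have "col (U2 * Z) j \<in> col_span p U1" if j: "j < k" for j
  proof -
    have "col (U2 * Z) j = U2 *\<^sub>v col Z1 j"
      using j UC assms(14) by (simp add: col_Z1 del: col_mult)
    also have "\<dots> = U2 *\<^sub>v (Z1 *\<^sub>v unit_vec m1 j)"
      using j assms(7) Z1C by (intro arg_cong[where f = "(*\<^sub>v) U2"] eq_vecI) auto
    also have "\<dots> = U1 *\<^sub>v unit_vec m1 j" using UC Z1C by (simp add: assms(20))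
    finally show ?thesis unfolding mem_col_span_iff[OF U1C] using unit_vec_carrier by blast
  qed
  hence UZ: "U2 * Z \<in> orthonormal_mats_in p k (col_span p U1)"
    using orthonormal_mats_mult[OF assms(10) Z] UC assms(14)
    by (auto simp: orthonormal_mats_in_def cols_def)
  have ratio_UZ: "trace_ratio A B (U2 * Z) = \<rho>" using ratio[OF Z] f_Z by simp
  \<comment> \<open>The smaller subspace admits fewer matrices, so the old maximum remains an upper
    bound.\<close>
  have le: "trace_ratio A B V \<le> \<rho>" if "V \<in> orthonormal_mats_in p k (col_span p U1)" for V
    using that in_sub max image unfolding is_maximum_def by blast
  have "is_arg_max ?f (\<lambda>Y. Y \<in> ?O) Z"
    using Z f_Z max by (auto simp: is_arg_max_def is_maximum_def not_less)
  moreover have "is_maximum (trace_ratio A B ` orthonormal_mats_in p k (col_span p U1)) \<rho>"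
    using UZ le ratio_UZ by (auto simp: is_maximum_def)
  moreover have "is_arg_max (trace_ratio A B) (\<lambda>V. V \<in> orthonormal_mats_in p k (col_span p U1)) (U2 * Z)"
    using UZ le ratio_UZ by (auto simp: is_arg_max_def not_less)
  ultimately show ?thesis using max sub by (simp add: image)
qed

end
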